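(* Let $X$ be a countable $\aleph_0$-space. Then $C_c(X)$ endowed with its weak topology $\sigma(C_c(X),C_c(X)')$ is an $\aleph_0$-space.
   Context: $C_c(X)$ is the space of continuous real functions on $X$ with the compact-open topology; its dual can be identified with the regular Borel measures on $X$ with compact support. A $k$-network is a family $\mathcal N$ such that whenever $K\subset U$ with $K$ compact and $U$ open, there is a finite $\mathcal F\subset\mathcal N$ with $K\subset\bigcup\mathcal F\subset U$; an $\aleph_0$-space is a regular space with a countable $k$-network. *)

theory Defs
  imports "HOL-Analysis.Analysis"
begin

definition k_network :: "'a topology \<Rightarrow> 'a set set \<Rightarrow> bool" where
  "k_network X \<N> \<longleftrightarrow>
     (\<forall>K U. compactin X K \<and> openin X U \<and> K \<subseteq> U \<longrightarrow>
        (\<exists>\<F>. finite \<F> \<and> \<F> \<subseteq> \<N> \<and> K \<subseteq> \<Union>\<F> \<and> \<Union>\<F> \<subseteq> U))"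

definition aleph0_space :: "'a topology \<Rightarrow> bool" where
  "aleph0_space X \<longleftrightarrow> regular_space X \<and> (\<exists>\<N>. countable \<N> \<and> k_network X \<N>)"

definition cfun :: "'a topology \<Rightarrow> ('a \<Rightarrow> real) set" where
  "cfun X = {f. continuous_map X euclideanreal f \<and> (\<forall>x. x \<notin> topspace X \<longrightarrow> f x = 0)}"

definition compact_open :: "'a topology \<Rightarrow> ('a \<Rightarrow> real) topology" where
  "compact_open X = topology_generated_by
     {{f \<in> cfun X. f ` K \<subseteq> U} | K U. compactin X K \<and> open U}"

definition cc_dual :: "'a topology \<Rightarrow> (('a \<Rightarrow> real) \<Rightarrow> real) set" where
  "cc_dual X = {\<phi>. continuous_map (compact_open X) euclideanreal \<phi> \<and>
     (\<forall>f\<in>cfun X. \<forall>g\<in>cfun X. \<forall>a b::real.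
        \<phi> (\<lambda>x. a * f x + b * g x) = a * \<phi> f + b * \<phi> g)}"

definition cc_weak :: "'a topology \<Rightarrow> ('a \<Rightarrow> real) topology" where
  "cc_weak X = topology_generated_by
     {{f \<in> cfun X. \<phi> f \<in> U} | \<phi> U. \<phi> \<in> cc_dual X \<and> open U}"

end

theory Submission
  imports Defs
begin

text \<open>
  A countable regular space has a clopen base. If a linear functional is bounded by the supremum
  over a compact set \<open>K\<close>, then, cutting functions along clopen sets, for every \<open>\<epsilon> > 0\<close> there is a
  finite \<open>F \<subseteq> K\<close> such that the functional is at most \<open>\<epsilon>\<close> on functions bounded by 1 on \<open>K\<close> and
  vanishing on \<open>F\<close>; this replaces the representation of the dual by measures. Hence on sets of
  functions uniformly bounded on the relevant compact sets the weak topology is the topology of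
  pointwise convergence, which is second countable because the space is countable. A weakly compact
  set is bounded on each compact set \<open>K\<close> by a gliding hump, and even on a finite intersection of
  finite unions of network sets containing \<open>K\<close>: otherwise points witnessing unboundedness could be
  chosen to converge to \<open>K\<close>, giving a larger compact set on which it is unbounded. Intersecting the
  boxes of a countable base of pointwise convergence with such boundedness conditions yields the
  k-network.
\<close>

section \<open>Continuous functions on countable regular spaces\<close>

text \<open>Countable spaces are Lindelof, so regularity gives normality and then complete
  regularity. A Urysohn function has only countably many values on \<open>X\<close>, and its
  sublevel set at a missed level is clopen.\<close>

lemma countable_regular_imp_dim_le_0:
  assumes "countable (topspace X)" "regular_space X"
  shows "X dim_le 0"
proof -
  have cr: "completely_regular_space X"
    using assms countable_imp_Lindelof_space regular_Lindelof_imp_normal_space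
      normal_imp_completely_regular_space by blast
  have "\<exists>V. closedin X V \<and> openin X V \<and> x \<in> V \<and> V \<subseteq> W" if W: "openin X W" "x \<in> W" for W x
  proof -
    have "closedin X (topspace X - W)" "x \<in> topspace X - (topspace X - W)"
      using W openin_subset by auto
    then obtain f :: "'a \<Rightarrow> real" where f: "continuous_map X (top_of_set {0..1}) f" "f x = 0"
      "f ` (topspace X - W) \<subseteq> {1}"
      using cr unfolding completely_regular_space_def by meson
    have fc: "continuous_map X euclideanreal f"
      using f(1) continuous_map_in_subtopology by blast
    \<comment> \<open>A value missed by the countable set of values of \<open>f\<close> cuts out a clopen set.\<close>
    have "uncountable ({0<..<1::real} - f ` topspace X)"
      using assms(1) by (intro uncountable_minus_countable) (auto simp: uncountable_open_interval)
    then obtain r where r: "0 < r" "r < 1" "r \<notin> f ` topspace X"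
      by (metis DiffE countable_empty ex_in_conv greaterThanLessThan_iff)
    have eq: "{y \<in> topspace X. f y \<in> {..<r}} = {y \<in> topspace X. f y \<in> {..r}}"
      using r by (force simp: less_le)
    have "openin X {y \<in> topspace X. f y \<in> {..<r}}"
      by (rule openin_continuous_map_preimage[OF fc]) auto
    moreover have "closedin X {y \<in> topspace X. f y \<in> {..<r}}"
      unfolding eq by (rule closedin_continuous_map_preimage[OF fc]) auto
    moreover have "{y \<in> topspace X. f y \<in> {..<r}} \<subseteq> W"
      using f(3) r by force
    moreover have "x \<in> {y \<in> topspace X. f y \<in> {..<r}}"
      using W openin_subset f r by auto
    ultimately show ?thesis by blast
  qed
  then have "neighbourhood_base_of (\<lambda>U. closedin X U \<and> openin X U) X"
    unfolding neighbourhood_base_of by (metis subset_refl)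
  then show ?thesis
    by (simp add: dimension_le_0_neighbourhood_base_of_clopen)
qed

lemma dim_le_0_clopen_neighbourhood:
  assumes "X dim_le 0" "openin X W" "x \<in> W"
  obtains V where "closedin X V" "openin X V" "x \<in> V" "V \<subseteq> W"
  using assms unfolding dimension_le_0_neighbourhood_base_of_clopen neighbourhood_base_of
  by (metis subsetD)

lemma cfun_lincomb:
  assumes "f \<in> cfun X" "g \<in> cfun X"
  shows "(\<lambda>x. a * f x + b * g x) \<in> cfun X"
  using assms unfolding cfun_def
  by (auto intro!: continuous_map_add continuous_map_real_mult_left)

lemma cfun_diff: "f \<in> cfun X \<Longrightarrow> g \<in> cfun X \<Longrightarrow> (\<lambda>x. f x - g x) \<in> cfun X"
  using cfun_lincomb[of f X g 1 "-1"] by simp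

text \<open>The condition \<open>h 0 = 0\<close> keeps the composite zero outside the space, as
  \<open>cfun X\<close> demands.\<close>

lemma cfun_compose:
  assumes "f \<in> cfun X" "continuous_on UNIV h" "h (0::real) = (0::real)"
  shows "(\<lambda>x. h (f x)) \<in> cfun X"
proof -
  have "continuous_map X euclideanreal (h \<circ> f)"
    using assms by (intro continuous_map_compose[of X euclideanreal]) (auto simp: cfun_def)
  then show ?thesis
    using assms by (auto simp: cfun_def o_def)
qed

text \<open>A clopen set has empty frontier, so the gluing condition is vacuous. These sharp
  cut-offs take the role of partitions of unity below.\<close>

lemma cfun_restrict_clopen:
  assumes "f \<in> cfun X" "openin X U" "closedin X U"
  shows "(\<lambda>x. if x \<in> U then f x else 0) \<in> cfun X"
proof -
  have "X frontier_of U = {}"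
    using assms(2,3) openin_subset[OF assms(2)] clopenin_eq_frontier_of[of X U] by simp
  then have "continuous_map X euclideanreal (\<lambda>x. if x \<in> U then f x else 0)"
    using assms
    by (intro continuous_map_cases) (auto simp: cfun_def continuous_map_from_subtopology)
  then show ?thesis
    using assms by (auto simp: cfun_def)
qed

lemma cfun_bounded_on_compact:
  assumes "f \<in> cfun X" "compactin X L" "L \<noteq> {}"
  obtains y where "y \<in> L" "\<And>x. x \<in> L \<Longrightarrow> \<bar>f x\<bar> \<le> \<bar>f y\<bar>"
proof -
  have "continuous_map X euclideanreal (\<lambda>x. \<bar>f x\<bar>)"
    using cfun_compose[OF assms(1) continuous_on_rabs[OF continuous_on_id]]
    by (simp add: cfun_def)
  then have "compact ((\<lambda>x. \<bar>f x\<bar>) ` L)"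
    using image_compactin[OF assms(2)] compactin_euclidean_iff by blast
  then obtain s where "s \<in> (\<lambda>x. \<bar>f x\<bar>) ` L" "\<forall>t\<in>(\<lambda>x. \<bar>f x\<bar>) ` L. t \<le> s"
    using assms(3) compact_attains_sup[of "(\<lambda>x. \<bar>f x\<bar>) ` L"] by auto
  then show ?thesis
    using that by auto
qed

section \<open>Functionals bounded on a compact set\<close>

text \<open>One seminorm estimate stands in place of continuity; \<open>cc_dual_iff\<close> shows
  that these are exactly the elements of the dual. \<open>K\<close> and \<open>C\<close> act as a
  compact support and a bound on the total variation of the representing measure.\<close>

locale compactly_bounded_functional =
  fixes X :: "'a topology" and K :: "'a set" and C :: real and \<phi> :: "('a \<Rightarrow> real) \<Rightarrow> real"
  assumes compact: "compactin X K"
    and lincomb: "\<And>f g a b. f \<in> cfun X \<Longrightarrow> g \<in> cfun X \<Longrightarrow>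
      \<phi> (\<lambda>x. a * f x + b * g x) = a * \<phi> f + b * \<phi> g"
    and bounded: "\<And>f. f \<in> cfun X \<Longrightarrow> (\<And>x. x \<in> K \<Longrightarrow> \<bar>f x\<bar> \<le> 1) \<Longrightarrow> \<bar>\<phi> f\<bar> \<le> C"
begin

lemma add: "f \<in> cfun X \<Longrightarrow> g \<in> cfun X \<Longrightarrow> \<phi> (\<lambda>x. f x + g x) = \<phi> f + \<phi> g"
  using lincomb[of f g 1 1] by simp

lemma diff: "f \<in> cfun X \<Longrightarrow> g \<in> cfun X \<Longrightarrow> \<phi> (\<lambda>x. f x - g x) = \<phi> f - \<phi> g"
  using lincomb[of f g 1 "-1"] by simp

lemma scale: "f \<in> cfun X \<Longrightarrow> \<phi> (\<lambda>x. c * f x) = c * \<phi> f"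
  using lincomb[of f f c 0] by simp

lemma zero_in_cfun: "(\<lambda>x. 0) \<in> cfun X"
  by (simp add: cfun_def)

lemma zero: "\<phi> (\<lambda>x. 0) = 0"
  using scale[OF zero_in_cfun, of 0] by simp

lemma C_nonneg: "0 \<le> C"
  using bounded[OF zero_in_cfun] zero by simp

lemma bounded_scaled:
  assumes "f \<in> cfun X" "m > 0" "\<And>x. x \<in> K \<Longrightarrow> \<bar>f x\<bar> \<le> m"
  shows "\<bar>\<phi> f\<bar> \<le> C * m"
proof -
  have "(\<lambda>x. (1 / m) * f x) \<in> cfun X"
    using cfun_lincomb[OF assms(1) assms(1), of "1/m" 0] by simp
  then have "\<bar>\<phi> (\<lambda>x. (1 / m) * f x)\<bar> \<le> C"
    using assms by (intro bounded) (auto simp: abs_mult divide_simps)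
  then show ?thesis
    using assms(2) by (simp only: scale[OF assms(1)]) (simp add: abs_mult field_simps)
qed

text \<open>\<open>f - g\<close> is bounded on \<open>K\<close> by every positive number, so
  \<open>bounded_scaled\<close> makes its value arbitrarily small. Only values on \<open>K\<close>
  count, as for a measure carried by \<open>K\<close>.\<close>

lemma cong_on_K:
  assumes "f \<in> cfun X" "g \<in> cfun X" "\<And>x. x \<in> K \<Longrightarrow> f x = g x"
  shows "\<phi> f = \<phi> g"
proof -
  have le: "\<bar>\<phi> (\<lambda>x. f x - g x)\<bar> \<le> C * e" if "e > 0" for e
    using assms that by (intro bounded_scaled cfun_diff) auto
  have "\<bar>\<phi> (\<lambda>x. f x - g x)\<bar> \<le> 0"
  proof (rule field_le_epsilon)
    fix e :: real assume "e > 0"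
    have "\<bar>\<phi> (\<lambda>x. f x - g x)\<bar> \<le> C * (e / (C + 1))"
      using \<open>e > 0\<close> C_nonneg by (intro le) auto
    also have "\<dots> \<le> 0 + e"
      using \<open>e > 0\<close> C_nonneg by (simp add: field_simps)
    finally show "\<bar>\<phi> (\<lambda>x. f x - g x)\<bar> \<le> 0 + e" .
  qed
  then show ?thesis
    using diff[OF assms(1,2)] by simp
qed

text \<open>Otherwise functions of sup norm at most 1 with pairwise disjoint supports
  shrinking to \<open>x\<close> would have a sum on which the functional is arbitrarily large.\<close>

lemma small_near_point:
  assumes dim: "X dim_le 0" and x: "x \<in> topspace X" and "e > 0"
  shows "\<exists>U. openin X U \<and> closedin X U \<and> x \<in> U \<and>
    (\<forall>g\<in>cfun X. (\<forall>y\<in>K. \<bar>g y\<bar> \<le> 1) \<and> g x = 0 \<longrightarrow>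
      \<bar>\<phi> (\<lambda>y. if y \<in> U then g y else 0)\<bar> \<le> e)"
proof (rule ccontr)
  assume "\<not> ?thesis"
  then have bad: "\<exists>g\<in>cfun X. (\<forall>y\<in>K. \<bar>g y\<bar> \<le> 1) \<and> g x = 0 \<and>
      \<bar>\<phi> (\<lambda>y. if y \<in> U then g y else 0)\<bar> > e"
    if "openin X U" "closedin X U" "x \<in> U" for U
    using that by (meson not_le)
  \<comment> \<open>Functions of size at most \<open>d\<close> on \<open>K\<close> contribute at
    most \<open>e / 2\<close>; the \<open>C + 1\<close> avoids division by zero when
    \<open>C = 0\<close>.\<close>
  define d where "d = e / (2 * (C + 1))"
  have d: "d > 0" "C * d \<le> e / 2"
    using \<open>e > 0\<close> C_nonneg by (auto simp: d_def field_simps)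
  \<comment> \<open>One hump: as \<open>g\<close> vanishes at \<open>x\<close>, it is smaller than
    \<open>d\<close> on some clopen \<open>V\<close> around \<open>x\<close>, so the part of
    \<open>g\<close> on \<open>U - V\<close> must account for more than
    \<open>e / 2\<close>.\<close>
  have step: "\<exists>h V. h \<in> cfun X \<and> openin X V \<and> closedin X V \<and> x \<in> V \<and> V \<subseteq> U \<and>
      (\<forall>y\<in>K. \<bar>h y\<bar> \<le> 1) \<and> (\<forall>y. y \<notin> U - V \<longrightarrow> h y = 0) \<and> \<phi> h > e / 2"
    if U: "openin X U" "closedin X U" "x \<in> U" for U
  proof -
    obtain g where g: "g \<in> cfun X" "\<forall>y\<in>K. \<bar>g y\<bar> \<le> 1" "g x = 0"
      and big: "\<bar>\<phi> (\<lambda>y. if y \<in> U then g y else 0)\<bar> > e"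
      using bad[OF U] by blast
    have "continuous_map X euclideanreal g"
      using g by (simp add: cfun_def)
    then have "openin X {y \<in> topspace X. g y \<in> {-d<..<d}}"
      by (rule openin_continuous_map_preimage) auto
    then have "openin X (U \<inter> {y \<in> topspace X. g y \<in> {-d<..<d}})"
      using U by blast
    moreover have "x \<in> U \<inter> {y \<in> topspace X. g y \<in> {-d<..<d}}"
      using U x g d by auto
    ultimately obtain V where V: "closedin X V" "openin X V" "x \<in> V"
      "V \<subseteq> U \<inter> {y \<in> topspace X. g y \<in> {-d<..<d}}"
      using dim_le_0_clopen_neighbourhood[OF dim] by blast
    define h where "h = (\<lambda>y. if y \<in> U - V then g y else 0)"
    have h: "h \<in> cfun X"
      unfolding h_def using g U V by (intro cfun_restrict_clopen) auto
    have gV: "(\<lambda>y. if y \<in> V then g y else 0) \<in> cfun X"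
      using g V by (intro cfun_restrict_clopen) auto
    have "\<bar>\<phi> (\<lambda>y. if y \<in> V then g y else 0)\<bar> \<le> C * d"
      using V d by (intro bounded_scaled[OF gV]) force+
    moreover have "(\<lambda>y. if y \<in> U then g y else 0) = (\<lambda>y. h y + (if y \<in> V then g y else 0))"
      using V by (auto simp: h_def fun_eq_iff)
    then have "\<phi> (\<lambda>y. if y \<in> U then g y else 0) = \<phi> h + \<phi> (\<lambda>y. if y \<in> V then g y else 0)"
      using add[OF h gV] by simp
    ultimately have h_big: "\<bar>\<phi> h\<bar> > e / 2"
      using big d(2) by linarith
    have "h y = 0" if "y \<notin> U - V" for y
      using that by (auto simp: h_def)
    moreover have "\<forall>y\<in>K. \<bar>h y\<bar> \<le> 1"
      using g by (auto simp: h_def)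
    \<comment> \<open>Multiplying by the sign makes the value positive, so that the contributions of
      successive humps add up.\<close>
    moreover have "(\<lambda>y. sgn (\<phi> h) * h y) \<in> cfun X"
      using cfun_lincomb[OF h h, of "sgn (\<phi> h)" 0] by simp
    moreover have "\<phi> (\<lambda>y. sgn (\<phi> h) * h y) > e / 2"
      using h_big by (simp only: scale[OF h]) (simp add: abs_sgn mult.commute)
    ultimately show ?thesis
      using V
      by (intro exI[of _ "\<lambda>y. sgn (\<phi> h) * h y"] exI[of _ V])
        (auto simp: abs_mult abs_sgn_eq)
  qed
  \<comment> \<open>Each new hump lives inside the set \<open>V\<close> where the previous sum
    vanishes, so the bound 1 on \<open>K\<close> survives while the value grows by more than
    \<open>e / 2\<close>.\<close>
  have "\<exists>h V. h \<in> cfun X \<and> openin X V \<and> closedin X V \<and> x \<in> V \<and>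
      (\<forall>y\<in>K. \<bar>h y\<bar> \<le> 1) \<and> (\<forall>y\<in>V. h y = 0) \<and> \<phi> h \<ge> real n * (e / 2)" for n
  proof (induction n)
    case 0
    show ?case
      using x zero_in_cfun zero
      by (intro exI[of _ "\<lambda>y. 0"] exI[of _ "topspace X"]) auto
  next
    case (Suc n)
    then obtain h V where h: "h \<in> cfun X" and V: "openin X V" "closedin X V" "x \<in> V"
      and hK: "\<forall>y\<in>K. \<bar>h y\<bar> \<le> 1" and hV: "\<forall>y\<in>V. h y = 0" and hn: "\<phi> h \<ge> real n * (e / 2)"
      by blast
    obtain k W where k: "k \<in> cfun X" and W: "openin X W" "closedin X W" "x \<in> W" "W \<subseteq> V"
      and kK: "\<forall>y\<in>K. \<bar>k y\<bar> \<le> 1" and k0: "\<And>y. y \<notin> V - W \<Longrightarrow> k y = 0" and kn: "\<phi> k > e / 2"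
      using step[OF V] by blast
    have "(\<lambda>y. h y + k y) \<in> cfun X"
      using cfun_lincomb[OF h k, of 1 1] by simp
    moreover have "\<bar>h y + k y\<bar> \<le> 1" if "y \<in> K" for y
      using hK kK hV k0[of y] that by (cases "y \<in> V") auto
    moreover have "\<phi> (\<lambda>y. h y + k y) \<ge> real (Suc n) * (e / 2)"
      using add[OF h k] hn kn by (simp add: algebra_simps)
    moreover have "h y + k y = 0" if "y \<in> W" for y
      using hV k0[of y] W that by auto
    ultimately show ?case
      using W by (intro exI[of _ "\<lambda>y. h y + k y"] exI[of _ W]) auto
  qed
  then have "real n * (e / 2) \<le> C" for n
    by (metis abs_le_D1 bounded order_trans)
  moreover obtain n where "C / (e / 2) < real n"
    using reals_Archimedean2 by blast
  then have "C < real n * (e / 2)"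
    using \<open>e > 0\<close> by (simp add: field_simps)
  ultimately show False
    by (meson not_le)
qed

text \<open>The sets \<open>U x\<close> may overlap. Peeling off one of them leaves \<open>g\<close>
  set to 0 there, a function that still satisfies the hypotheses, which is why the induction
  generalises \<open>g\<close>.\<close>

lemma small_on_union:
  assumes "finite F"
    and U: "\<And>x. x \<in> F \<Longrightarrow> openin X (U x) \<and> closedin X (U x) \<and>
      (\<forall>g\<in>cfun X. (\<forall>y\<in>K. \<bar>g y\<bar> \<le> 1) \<and> g x = 0 \<longrightarrow>
        \<bar>\<phi> (\<lambda>y. if y \<in> U x then g y else 0)\<bar> \<le> \<epsilon> x)"
    and "g \<in> cfun X" "\<forall>y\<in>K. \<bar>g y\<bar> \<le> 1" "\<forall>x\<in>F. g x = 0"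
  shows "\<bar>\<phi> (\<lambda>y. if y \<in> (\<Union>x\<in>F. U x) then g y else 0)\<bar> \<le> (\<Sum>x\<in>F. \<epsilon> x)"
  using assms
proof (induction F arbitrary: g rule: finite_induct)
  case empty
  then show ?case by (simp add: zero)
next
  case (insert x F)
  define V where "V = (\<Union>x\<in>F. U x)"
  define k where "k = (\<lambda>y. if y \<in> topspace X - U x then g y else 0)"
  have Ux: "openin X (U x)" "closedin X (U x)"
    using insert.prems(1) by auto
  have V: "openin X V" "closedin X V"
    unfolding V_def using insert.prems(1) insert.hyps(1) by (auto intro!: closedin_Union)
  have k: "k \<in> cfun X"
    unfolding k_def using insert.prems Ux by (intro cfun_restrict_clopen) auto
  have k1: "(\<lambda>y. if y \<in> V then k y else 0) \<in> cfun X"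
    using k V by (intro cfun_restrict_clopen) auto
  have g1: "(\<lambda>y. if y \<in> U x then g y else 0) \<in> cfun X"
    using insert.prems Ux by (intro cfun_restrict_clopen) auto
  have "(\<lambda>y. if y \<in> (\<Union>x\<in>insert x F. U x) then g y else 0) =
      (\<lambda>y. (if y \<in> U x then g y else 0) + (if y \<in> V then k y else 0))"
    using openin_subset[OF V(1)] by (auto simp: fun_eq_iff k_def V_def)
  then have "\<phi> (\<lambda>y. if y \<in> (\<Union>x\<in>insert x F. U x) then g y else 0) =
      \<phi> (\<lambda>y. if y \<in> U x then g y else 0) + \<phi> (\<lambda>y. if y \<in> V then k y else 0)"
    by (simp only: add[OF g1 k1])
  moreover have "\<bar>\<phi> (\<lambda>y. if y \<in> U x then g y else 0)\<bar> \<le> \<epsilon> x"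
    using insert.prems by simp
  moreover have "\<bar>\<phi> (\<lambda>y. if y \<in> V then k y else 0)\<bar> \<le> (\<Sum>x\<in>F. \<epsilon> x)"
    unfolding V_def using insert.prems
    by (intro insert.IH k) (auto simp: k_def)
  ultimately show ?case
    using insert.hyps by simp
qed

text \<open>Compactness cuts the clopen sets of \<open>small_near_point\<close> down to a finite
  cover of \<open>K\<close>, and tolerances summing to at most \<open>e\<close> control the pieces
  together.\<close>

lemma small_if_zero_on_finite:
  assumes dim: "X dim_le 0" and count: "countable (topspace X)" and "e > 0"
  shows "\<exists>F. finite F \<and> F \<subseteq> K \<and>
    (\<forall>g\<in>cfun X. (\<forall>y\<in>K. \<bar>g y\<bar> \<le> 1) \<and> (\<forall>x\<in>F. g x = 0) \<longrightarrow> \<bar>\<phi> g\<bar> \<le> e)"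
proof -
  define \<iota> where "\<iota> = to_nat_on (topspace X)"
  have inj: "inj_on \<iota> (topspace X)"
    unfolding \<iota>_def by (rule inj_on_to_nat_on[OF count])
  have KX: "K \<subseteq> topspace X"
    using compact compactin_subset_topspace by blast
  \<comment> \<open>The tolerances must be fixed before the finite cover is known. Along an
    injective enumeration of the space they are distinct terms of a series with sum
    \<open>e\<close>.\<close>
  define \<epsilon> where "\<epsilon> x = e * (1 / 2) ^ Suc (\<iota> x)" for x
  have "\<forall>x\<in>topspace X. \<exists>U. openin X U \<and> closedin X U \<and> x \<in> U \<and>
    (\<forall>g\<in>cfun X. (\<forall>y\<in>K. \<bar>g y\<bar> \<le> 1) \<and> g x = 0 \<longrightarrow>
      \<bar>\<phi> (\<lambda>y. if y \<in> U then g y else 0)\<bar> \<le> \<epsilon> x)"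
    using \<open>e > 0\<close> by (intro ballI small_near_point[OF dim]) (auto simp: \<epsilon>_def)
  then obtain U where U: "\<And>x. x \<in> topspace X \<Longrightarrow> openin X (U x) \<and> closedin X (U x) \<and> x \<in> U x \<and>
    (\<forall>g\<in>cfun X. (\<forall>y\<in>K. \<bar>g y\<bar> \<le> 1) \<and> g x = 0 \<longrightarrow>
      \<bar>\<phi> (\<lambda>y. if y \<in> U x then g y else 0)\<bar> \<le> \<epsilon> x)"
    by metis
  have "\<exists>\<F>. finite \<F> \<and> \<F> \<subseteq> U ` K \<and> K \<subseteq> \<Union>\<F>"
    using U KX by (intro compactinD[OF compact]) auto
  then obtain F where F: "finite F" "F \<subseteq> K" "K \<subseteq> (\<Union>x\<in>F. U x)"
    by (metis finite_subset_image)
  have sum: "(\<Sum>x\<in>F. \<epsilon> x) \<le> e"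
  proof -
    have "(\<Sum>x\<in>F. (1 / 2 :: real) ^ Suc (\<iota> x)) = (\<Sum>n\<in>\<iota> ` F. (1 / 2) ^ Suc n)"
      using F KX inj by (subst sum.reindex) (auto intro: inj_on_subset)
    also have "\<dots> \<le> (\<Sum>n. (1 / 2) ^ Suc n)"
      using F power_half_series by (intro sum_le_suminf) (auto simp: sums_iff)
    also have "\<dots> = 1"
      using power_half_series by (simp add: sums_iff)
    finally have "e * (\<Sum>x\<in>F. (1 / 2 :: real) ^ Suc (\<iota> x)) \<le> e * 1"
      using \<open>e > 0\<close> by (intro mult_left_mono) auto
    then show ?thesis
      by (simp only: \<epsilon>_def sum_distrib_left mult_1_right)
  qed
  have "\<bar>\<phi> g\<bar> \<le> e" if g: "g \<in> cfun X" "\<forall>y\<in>K. \<bar>g y\<bar> \<le> 1" "\<forall>x\<in>F. g x = 0" for g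
  proof -
    have "openin X (U x) \<and> closedin X (U x)" if "x \<in> F" for x
      using U[of x] F KX that by blast
    then have UF: "openin X (\<Union>x\<in>F. U x)" "closedin X (\<Union>x\<in>F. U x)"
      using F(1) by (auto intro!: closedin_Union)
    \<comment> \<open>\<open>g\<close> and its cut-off agree on \<open>K\<close>, which the clopen
      sets cover.\<close>
    have "\<phi> g = \<phi> (\<lambda>y. if y \<in> (\<Union>x\<in>F. U x) then g y else 0)"
      using F by (intro cong_on_K g(1) cfun_restrict_clopen UF) auto
    moreover have "\<bar>\<phi> (\<lambda>y. if y \<in> (\<Union>x\<in>F. U x) then g y else 0)\<bar> \<le> (\<Sum>x\<in>F. \<epsilon> x)"
      using U F KX g by (intro small_on_union) auto
    ultimately show ?thesis
      using sum by simp
  qed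
  then show ?thesis
    using F by blast
qed

text \<open>The difference \<open>h = g - f\<close> splits into its truncation at height
  \<open>d\<close>, which is uniformly small, and a remainder that vanishes on \<open>F\<close> and
  is at most \<open>2 * m\<close> on \<open>K\<close>, so that
  \<open>small_if_zero_on_finite\<close> controls it after rescaling.\<close>

lemma pointwise_continuous_on_bounded:
  assumes dim: "X dim_le 0" and count: "countable (topspace X)" and "e > 0" and m: "m > 0"
    and f: "f \<in> cfun X" "\<And>x. x \<in> K \<Longrightarrow> \<bar>f x\<bar> \<le> m"
  shows "\<exists>F d. finite F \<and> F \<subseteq> K \<and> d > 0 \<and>
    (\<forall>g\<in>cfun X. (\<forall>x\<in>K. \<bar>g x\<bar> \<le> m) \<and> (\<forall>x\<in>F. \<bar>g x - f x\<bar> \<le> d) \<longrightarrow> \<bar>\<phi> g - \<phi> f\<bar> < e)"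
proof -
  \<comment> \<open>The factor \<open>2 * m\<close> undoes the rescaling of the remainder, leaving
    \<open>e / 4\<close>.\<close>
  define \<eta> where "\<eta> = e / (4 * (2 * m))"
  have "\<eta> > 0"
    using \<open>e > 0\<close> m by (simp add: \<eta>_def)
  obtain F where F: "finite F" "F \<subseteq> K"
    "\<And>g. g \<in> cfun X \<Longrightarrow> (\<forall>y\<in>K. \<bar>g y\<bar> \<le> 1) \<Longrightarrow> (\<forall>x\<in>F. g x = 0) \<Longrightarrow> \<bar>\<phi> g\<bar> \<le> \<eta>"
    using small_if_zero_on_finite[OF dim count \<open>\<eta> > 0\<close>] by metis
  define d where "d = e / (4 * (C + 1))"
  have d: "d > 0" "C * d \<le> e / 4"
    using \<open>e > 0\<close> C_nonneg by (auto simp: d_def field_simps)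
  have "\<bar>\<phi> g - \<phi> f\<bar> < e"
    if g: "g \<in> cfun X" "\<forall>x\<in>K. \<bar>g x\<bar> \<le> m" "\<forall>x\<in>F. \<bar>g x - f x\<bar> \<le> d" for g
  proof -
    define h where "h = (\<lambda>x. g x - f x)"
    define clip where "clip t = max (- d) (min d t)" for t :: real
    have h: "h \<in> cfun X"
      unfolding h_def by (intro cfun_diff g f)
    have clip_cont: "continuous_on UNIV clip"
      unfolding clip_def by (intro continuous_intros)
    have c: "(\<lambda>x. clip (h x)) \<in> cfun X"
      using d clip_cont by (intro cfun_compose[OF h]) (auto simp: clip_def)
    have r: "(\<lambda>x. h x - clip (h x)) \<in> cfun X"
      by (intro cfun_diff h c)
    have r1: "(\<lambda>x. (1 / (2 * m)) * (h x - clip (h x))) \<in> cfun X"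
      using cfun_lincomb[OF r r, of "1 / (2 * m)" 0] by simp
    have "\<bar>\<phi> (\<lambda>x. (1 / (2 * m)) * (h x - clip (h x)))\<bar> \<le> \<eta>"
    proof (rule F(3)[OF r1])
      have "\<bar>h y - clip (h y)\<bar> \<le> 2 * m" if "y \<in> K" for y
      proof -
        have "\<bar>h y\<bar> \<le> 2 * m"
          using g(2) f(2)[OF that] that by (force simp: h_def)
        then show ?thesis
          using d(1) unfolding clip_def by linarith
      qed
      then show "\<forall>y\<in>K. \<bar>1 / (2 * m) * (h y - clip (h y))\<bar> \<le> 1"
        using m by (simp add: abs_mult)
      show "\<forall>x\<in>F. 1 / (2 * m) * (h x - clip (h x)) = 0"
        using g(3) by (fastforce simp: h_def clip_def)
    qed
    then have "\<bar>\<phi> (\<lambda>x. h x - clip (h x))\<bar> \<le> e / 4"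
      using m by (simp only: scale[OF r]) (simp add: \<eta>_def abs_mult field_simps)
    moreover have "\<bar>\<phi> (\<lambda>x. clip (h x))\<bar> \<le> C * d"
      using d by (intro bounded_scaled[OF c]) (auto simp: clip_def)
    moreover have "\<phi> h = \<phi> (\<lambda>x. h x - clip (h x)) + \<phi> (\<lambda>x. clip (h x))"
      using diff[OF h c] by simp
    moreover have "\<phi> h = \<phi> g - \<phi> f"
      unfolding h_def by (intro diff g f)
    ultimately show ?thesis
      using d \<open>e > 0\<close> by linarith
  qed
  then show ?thesis
    using F d by blast
qed

end

section \<open>The dual of the compact-open topology\<close>

lemma topspace_compact_open: "topspace (compact_open X) = cfun X"
proof -
  have "cfun X \<in> {{f \<in> cfun X. f ` K \<subseteq> U} | K U. compactin X K \<and> open U}"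
    by (rule CollectI, rule exI[of _ "{}"], rule exI[of _ UNIV]) auto
  then show ?thesis
    unfolding compact_open_def topology_generated_by_topspace by auto
qed

text \<open>A uniform neighbourhood of \<open>f\<close> on \<open>K\<close> has to be assembled from
  subbasic sets: \<open>K\<close> is split into finitely many compact pieces on which
  \<open>f\<close> is nearly constant, and \<open>g\<close> is confined to a ball on each
  piece.\<close>

lemma (in compactly_bounded_functional) in_cc_dual: "\<phi> \<in> cc_dual X"
proof -
  have "openin (compact_open X) {f \<in> cfun X. \<phi> f \<in> U}" if "open U" for U
  proof (subst openin_subopen, rule ballI)
    fix f assume "f \<in> {f \<in> cfun X. \<phi> f \<in> U}"
    then have f: "f \<in> cfun X" "\<phi> f \<in> U" by auto
    obtain e where e: "e > 0" "ball (\<phi> f) e \<subseteq> U"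
      using f \<open>open U\<close> open_contains_ball by blast
    define d where "d = e / (2 * (C + 1))"
    have "0 < e * (C + 2)"
      using e C_nonneg by simp
    then have d: "d > 0" "C * d < e"
      using e C_nonneg by (auto simp: d_def field_simps)
    have fc: "continuous_map X euclideanreal f"
      using f by (simp add: cfun_def)
    have "compact (f ` K)"
      using image_compactin[OF compact fc] compactin_euclidean_iff by blast
    then obtain A where A: "finite A" "f ` K \<subseteq> (\<Union>c\<in>A. ball c (d/3))"
      using d by (metis compact_eq_totally_bounded zero_less_divide_iff zero_less_numeral)
    \<comment> \<open>Closed balls keep the pieces compact. The larger radius \<open>d/2\<close>
      below leaves room for \<open>f\<close> itself, and \<open>d/3 + d/2 < d\<close> gives the
      uniform estimate.\<close>
    define Kc where "Kc c = K \<inter> {x \<in> topspace X. f x \<in> cball c (d/3)}" for c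
    \<comment> \<open>The explicit \<open>cfun X\<close> handles an empty \<open>A\<close>, whose
      intersection would be everything.\<close>
    define T where "T = cfun X \<inter> (\<Inter>c\<in>A. {g \<in> cfun X. g ` Kc c \<subseteq> ball c (d/2)})"
    have "compactin X (Kc c)" for c
      unfolding Kc_def
      by (intro compact_Int_closedin[OF compact] closedin_continuous_map_preimage[OF fc]) auto
    then have "openin (compact_open X) {g \<in> cfun X. g ` Kc c \<subseteq> ball c (d/2)}" for c
      unfolding compact_open_def by (intro topology_generated_by_Basis) auto
    moreover have "openin (compact_open X) (cfun X)"
      using openin_topspace[of "compact_open X"] by (simp add: topspace_compact_open)
    ultimately have "openin (compact_open X) T"
      unfolding T_def using A(1)
      by (cases "A = {}") (auto intro!: openin_Int openin_Inter)
    moreover have "f \<in> T"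
      using d f by (auto simp: T_def Kc_def)
    moreover have "T \<subseteq> {f \<in> cfun X. \<phi> f \<in> U}"
    proof
      fix g assume "g \<in> T"
      then have g: "g \<in> cfun X" and gA: "\<And>c. c \<in> A \<Longrightarrow> g ` Kc c \<subseteq> ball c (d/2)"
        by (auto simp: T_def)
      have "\<bar>g x - f x\<bar> \<le> d" if "x \<in> K" for x
      proof -
        obtain c where c: "c \<in> A" "f x \<in> ball c (d/3)"
          using A(2) \<open>x \<in> K\<close> by blast
        moreover have "x \<in> Kc c"
          using c that compactin_subset_topspace[OF compact] by (auto simp: Kc_def)
        ultimately have "g x \<in> ball c (d/2)"
          using gA by blast
        then show ?thesis
          using c(2) d(1) unfolding mem_ball dist_real_def by argo
      qed
      then have "\<bar>\<phi> (\<lambda>x. g x - f x)\<bar> \<le> C * d"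
        by (intro bounded_scaled cfun_diff g f d) auto
      then have "\<phi> g \<in> ball (\<phi> f) e"
        using diff[OF g f(1)] d by (auto simp: dist_real_def)
      then show "g \<in> {f \<in> cfun X. \<phi> f \<in> U}"
        using g e by auto
    qed
    ultimately show "\<exists>T. openin (compact_open X) T \<and> f \<in> T \<and> T \<subseteq> {f \<in> cfun X. \<phi> f \<in> U}"
      by blast
  qed
  then have "continuous_map (compact_open X) euclideanreal \<phi>"
    by (auto simp: continuous_map_def topspace_compact_open)
  then show ?thesis
    using lincomb by (auto simp: cc_dual_def)
qed

text \<open>Induction on the generation of open sets: intersections take the union of the compact
  sets and the smaller radius, and a subbasic set with nonempty \<open>K\<close> has 0 in
  \<open>U\<close>.\<close>

lemma compact_open_neighbourhood_zero:
  assumes "openin (compact_open X) W" "(\<lambda>x. 0) \<in> W"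
  shows "\<exists>K d. compactin X K \<and> d > 0 \<and> (\<forall>g\<in>cfun X. (\<forall>x\<in>K. \<bar>g x\<bar> < d) \<longrightarrow> g \<in> W)"
proof -
  have "generate_topology_on {{f \<in> cfun X. f ` K \<subseteq> U} | K U. compactin X K \<and> open U} W"
    using assms(1) by (simp add: compact_open_def openin_topology_generated_by_iff)
  then show ?thesis
    using assms(2)
  proof induction
    case Empty
    then show ?case by simp
  next
    case (Int a b)
    then obtain K d L e where "compactin X K" "d > 0" "compactin X L" "e > 0"
      and *: "\<forall>g\<in>cfun X. (\<forall>x\<in>K. \<bar>g x\<bar> < d) \<longrightarrow> g \<in> a" "\<forall>g\<in>cfun X. (\<forall>x\<in>L. \<bar>g x\<bar> < e) \<longrightarrow> g \<in> b"
      by auto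
    then have "compactin X (K \<union> L)" "min d e > 0"
      by (auto intro: compactin_Un)
    moreover have "\<forall>g\<in>cfun X. (\<forall>x\<in>K \<union> L. \<bar>g x\<bar> < min d e) \<longrightarrow> g \<in> a \<inter> b"
      using * by auto
    ultimately show ?case by blast
  next
    case (UN \<K>)
    then obtain k where k: "k \<in> \<K>" "(\<lambda>x. 0) \<in> k"
      by blast
    show ?case
      using UN.IH[OF k] k(1) by (meson UnionI)
  next
    case (Basis s)
    then obtain K U where s: "s = {f \<in> cfun X. f ` K \<subseteq> U}" "compactin X K" "open U"
      by auto
    show ?case
    proof (cases "K = {}")
      case True
      then show ?thesis
        using s by (intro exI[of _ "{}"] exI[of _ 1]) auto
    next
      case False
      then have "0 \<in> U"
        using Basis s by auto
      then obtain d where "d > 0" "ball 0 d \<subseteq> U"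
        using s open_contains_ball by blast
      then show ?thesis
        using s by (intro exI[of _ K] exI[of _ d]) (auto simp: subset_iff dist_real_def)
    qed
  qed
qed

lemma cc_dual_iff:
  "\<phi> \<in> cc_dual X \<longleftrightarrow> (\<exists>K C. compactly_bounded_functional X K C \<phi>)"
proof
  assume \<phi>: "\<phi> \<in> cc_dual X"
  then have lin: "\<phi> (\<lambda>x. a * f x + b * g x) = a * \<phi> f + b * \<phi> g"
    if "f \<in> cfun X" "g \<in> cfun X" for f g a b
    using that by (auto simp: cc_dual_def)
  have 0: "(\<lambda>x. 0) \<in> cfun X"
    by (simp add: cfun_def)
  have "\<phi> (\<lambda>x. 0) = 0"
    using lin[OF 0 0, of 0 0] by simp
  moreover have "openin (compact_open X) {f \<in> topspace (compact_open X). \<phi> f \<in> {-1<..<1}}"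
    using \<phi> by (intro openin_continuous_map_preimage[of _ euclideanreal]) (auto simp: cc_dual_def)
  ultimately obtain K d where K: "compactin X K" "d > 0"
    "\<And>g. g \<in> cfun X \<Longrightarrow> (\<forall>x\<in>K. \<bar>g x\<bar> < d) \<Longrightarrow> \<bar>\<phi> g\<bar> < 1"
    using compact_open_neighbourhood_zero[of X "{f \<in> topspace (compact_open X). \<phi> f \<in> {-1<..<1}}"] 0
    by (force simp: topspace_compact_open abs_less_iff)
  \<comment> \<open>The neighbourhood of zero asks for values strictly below \<open>d\<close>;
    scaling by \<open>d / 2\<close> achieves this and costs the factor 2 in the constant.\<close>
  have "\<bar>\<phi> f\<bar> \<le> 2 / d" if f: "f \<in> cfun X" "\<And>x. x \<in> K \<Longrightarrow> \<bar>f x\<bar> \<le> 1" for f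
  proof -
    have "(\<lambda>x. d / 2 * f x) \<in> cfun X"
      using cfun_lincomb[OF f(1) f(1), of "d/2" 0] by simp
    moreover have "\<bar>d / 2 * f x\<bar> < d" if "x \<in> K" for x
    proof -
      have "\<bar>d / 2 * f x\<bar> \<le> d / 2 * 1"
        unfolding abs_mult using f(2)[OF that] K(2) by (intro mult_mono) auto
      then show ?thesis
        using K(2) by linarith
    qed
    ultimately have "\<bar>\<phi> (\<lambda>x. d / 2 * f x)\<bar> < 1"
      using K(3) by blast
    then show ?thesis
      using lin[OF f(1) f(1), of "d/2" 0] K(2) by (simp add: abs_mult field_simps)
  qed
  then have "compactly_bounded_functional X K (2 / d) \<phi>"
    using K lin by unfold_locales auto
  then show "\<exists>K C. compactly_bounded_functional X K C \<phi>"
    by blast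
qed (blast intro: compactly_bounded_functional.in_cc_dual)

section \<open>Point evaluations and their weighted sums\<close>

lemma evaluation_in_cc_dual:
  assumes "x \<in> topspace X"
  shows "(\<lambda>f. f x) \<in> cc_dual X"
proof -
  have "compactly_bounded_functional X {x} 1 (\<lambda>f. f x)"
    using assms by unfold_locales auto
  then show ?thesis
    by (rule compactly_bounded_functional.in_cc_dual)
qed

text \<open>The functional of a discrete measure with mass \<open>4^-n\<close> at
  \<open>y n\<close>. With ratio 1/4 the masses after index \<open>n\<close> total a third of the
  \<open>n\<close>-th one, which the gliding hump exploits.\<close>

lemma weighted_evaluations_in_cc_dual:
  assumes L: "compactin X L" and y: "\<And>n::nat. y n \<in> L"
  shows "(\<lambda>f. \<Sum>n. f (y n) / 4 ^ n) \<in> cc_dual X"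
proof (cases "L = {}")
  case True
  then show ?thesis
    using y by auto
next
  case False
  have geo: "summable (\<lambda>n. c * (1 / 4 :: real) ^ n)" for c
    by (intro summable_mult summable_geometric) auto
  have sm: "summable (\<lambda>n. f (y n) / 4 ^ n)" if "f \<in> cfun X" for f
  proof -
    obtain z where z: "\<And>x. x \<in> L \<Longrightarrow> \<bar>f x\<bar> \<le> \<bar>f z\<bar>"
      using cfun_bounded_on_compact[OF \<open>f \<in> cfun X\<close> L False] by metis
    show ?thesis
      using z[OF y] by (intro summable_comparison_test'[OF geo, of 0 _ "\<bar>f z\<bar>"])
        (auto simp: field_simps)
  qed
  have "compactly_bounded_functional X L (\<Sum>n. 1 * (1 / 4) ^ n) (\<lambda>f. \<Sum>n. f (y n) / 4 ^ n)"
  proof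
    fix f g a b assume fg: "f \<in> cfun X" "g \<in> cfun X"
    have "(\<lambda>n. a * (f (y n) / 4 ^ n) + b * (g (y n) / 4 ^ n)) sums
        (a * (\<Sum>n. f (y n) / 4 ^ n) + b * (\<Sum>n. g (y n) / 4 ^ n))"
      by (intro sums_add sums_mult summable_sums sm fg)
    then show "(\<Sum>n. (a * f (y n) + b * g (y n)) / 4 ^ n) =
        a * (\<Sum>n. f (y n) / 4 ^ n) + b * (\<Sum>n. g (y n) / 4 ^ n)"
      by (simp add: sums_iff add_divide_distrib)
  next
    fix f assume "f \<in> cfun X" and f: "\<And>x. x \<in> L \<Longrightarrow> \<bar>f x\<bar> \<le> 1"
    have "norm (\<Sum>n. f (y n) / 4 ^ n) \<le> (\<Sum>n. 1 * (1 / 4) ^ n)"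
      using f[OF y] by (intro norm_suminf_le geo) (auto simp: field_simps)
    then show "\<bar>\<Sum>n. f (y n) / 4 ^ n\<bar> \<le> (\<Sum>n. 1 * (1 / 4) ^ n)"
      by simp
  qed (rule L)
  then show ?thesis
    by (rule compactly_bounded_functional.in_cc_dual)
qed

section \<open>The weak topology\<close>

lemma topspace_cc_weak: "topspace (cc_weak X) = cfun X"
proof -
  have "(\<lambda>f. 0) \<in> cc_dual X"
    by (auto simp: cc_dual_def)
  then have "cfun X \<in> {{f \<in> cfun X. \<phi> f \<in> U} | \<phi> U. \<phi> \<in> cc_dual X \<and> open U}"
    by (intro CollectI exI[of _ "\<lambda>f. 0"] exI[of _ UNIV]) auto
  then show ?thesis
    unfolding cc_weak_def topology_generated_by_topspace by auto
qed

lemma openin_cc_weak_preimage: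
  "\<phi> \<in> cc_dual X \<Longrightarrow> open U \<Longrightarrow> openin (cc_weak X) {f \<in> cfun X. \<phi> f \<in> U}"
  unfolding cc_weak_def by (intro topology_generated_by_Basis) auto

lemma continuous_map_cc_weak: "\<phi> \<in> cc_dual X \<Longrightarrow> continuous_map (cc_weak X) euclideanreal \<phi>"
  by (auto simp: continuous_map_def topspace_cc_weak openin_cc_weak_preimage)

text \<open>The preimage of a closed ball under a dual functional is a closed neighbourhood inside a
  subbasic set; finite intersections and arbitrary unions preserve the existence of one.\<close>

lemma regular_space_cc_weak: "regular_space (cc_weak X)"
proof -
  have "\<exists>U V. openin (cc_weak X) U \<and> closedin (cc_weak X) V \<and> f \<in> U \<and> U \<subseteq> V \<and> V \<subseteq> W"
    if "openin (cc_weak X) W" "f \<in> W" for W f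
  proof -
    have "generate_topology_on {{f \<in> cfun X. \<phi> f \<in> U} | \<phi> U. \<phi> \<in> cc_dual X \<and> open U} W"
      using that(1) by (simp add: cc_weak_def openin_topology_generated_by_iff)
    then show ?thesis
      using that(2)
    proof induction
      case Empty
      then show ?case by simp
    next
      case (Int a b)
      then obtain U V U' V' where
        "openin (cc_weak X) U" "closedin (cc_weak X) V" "f \<in> U" "U \<subseteq> V" "V \<subseteq> a"
        "openin (cc_weak X) U'" "closedin (cc_weak X) V'" "f \<in> U'" "U' \<subseteq> V'" "V' \<subseteq> b"
        by auto
      then show ?case
        by (intro exI[of _ "U \<inter> U'"] exI[of _ "V \<inter> V'"]) auto
    next
      case (UN \<K>)
      then obtain k where k: "k \<in> \<K>" "f \<in> k"
        by blast
      show ?case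
        using UN.IH[OF k] k(1) by (meson Union_upper order_trans)
    next
      case (Basis s)
      then obtain \<phi> U where s: "s = {f \<in> cfun X. \<phi> f \<in> U}" "\<phi> \<in> cc_dual X" "open U"
        by auto
      then obtain e where e: "e > 0" "cball (\<phi> f) e \<subseteq> U"
        using Basis open_contains_cball by blast
      have "openin (cc_weak X) {g \<in> cfun X. \<phi> g \<in> ball (\<phi> f) e}"
        using s by (intro openin_cc_weak_preimage) auto
      moreover have "closedin (cc_weak X) {g \<in> topspace (cc_weak X). \<phi> g \<in> cball (\<phi> f) e}"
        using s
        by (intro closedin_continuous_map_preimage[of _ euclideanreal] continuous_map_cc_weak) auto
      ultimately show ?case
        using Basis s e
        by (intro exI[of _ "{g \<in> cfun X. \<phi> g \<in> ball (\<phi> f) e}"]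
            exI[of _ "{g \<in> cfun X. \<phi> g \<in> cball (\<phi> f) e}"]) (auto simp: topspace_cc_weak)
    qed
  qed
  then show ?thesis
    unfolding neighbourhood_base_of_closedin[symmetric] neighbourhood_base_of by blast
qed

section \<open>Boundedness of weakly compact sets\<close>

lemma weakly_compact_imp_functional_bounded:
  assumes "compactin (cc_weak X) Q" "\<phi> \<in> cc_dual X"
  shows "\<exists>b. \<forall>f\<in>Q. \<bar>\<phi> f\<bar> \<le> b"
proof -
  have "compact (\<phi> ` Q)"
    using image_compactin[OF assms(1) continuous_map_cc_weak[OF assms(2)]]
      compactin_euclidean_iff by blast
  then have "bounded (\<phi> ` Q)"
    by (rule compact_imp_bounded)
  then show ?thesis
    by (auto simp: bounded_iff)
qed

text \<open>A gliding hump: if \<open>Q\<close> were unbounded on \<open>L\<close>, a weighted sum of point evaluations at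
  rapidly chosen points of \<open>L\<close> would be unbounded on \<open>Q\<close>.\<close>

lemma weakly_compact_imp_bounded_on_compact:
  assumes Q: "compactin (cc_weak X) Q" and L: "compactin X L"
  shows "\<exists>m. \<forall>f\<in>Q. \<forall>x\<in>L. \<bar>f x\<bar> \<le> m"
proof (rule ccontr)
  assume "\<not> ?thesis"
  then have unbdd: "\<exists>f\<in>Q. \<exists>x\<in>L. \<bar>f x\<bar> > m" for m
    by (meson not_le)
  have QX: "Q \<subseteq> cfun X"
    using compactin_subset_topspace[OF Q] by (simp add: topspace_cc_weak)
  have LX: "L \<subseteq> topspace X"
    using compactin_subset_topspace[OF L] .
  \<comment> \<open>Taking \<open>y\<close> where \<open>\<bar>f\<bar>\<close> is maximal on
    \<open>L\<close> lets \<open>\<bar>f y\<bar>\<close> bound the numerators of all later terms of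
    the series.\<close>
  have peak: "\<exists>f\<in>Q. \<exists>y\<in>L. \<bar>f y\<bar> > m \<and> (\<forall>x\<in>L. \<bar>f x\<bar> \<le> \<bar>f y\<bar>)" for m
  proof -
    obtain f x where f: "f \<in> Q" "x \<in> L" "\<bar>f x\<bar> > m"
      using unbdd by blast
    then obtain y where "y \<in> L" "\<And>x. x \<in> L \<Longrightarrow> \<bar>f x\<bar> \<le> \<bar>f y\<bar>"
      using cfun_bounded_on_compact[of f X L] QX L by blast
    then show ?thesis
      using f by (meson less_le_trans)
  qed
  \<comment> \<open>Point evaluations lie in the dual, so \<open>Q\<close> is bounded at each point,
    though not yet uniformly on \<open>L\<close>.\<close>
  have "\<forall>y\<in>L. \<exists>b. \<forall>f\<in>Q. \<bar>f y\<bar> \<le> b"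
    using LX by (intro ballI weakly_compact_imp_functional_bounded[OF Q] evaluation_in_cc_dual) auto
  then obtain B where B: "\<And>y f. y \<in> L \<Longrightarrow> f \<in> Q \<Longrightarrow> \<bar>f y\<bar> \<le> B y"
    by metis
  \<comment> \<open>\<open>M\<close> is to bound the sum of the first \<open>n\<close> terms
    uniformly over \<open>Q\<close>. Since the tail is at most a third of the \<open>n\<close>-th
    term, the factor 3/2 leaves more than \<open>M + n\<close> after the tail and more than
    \<open>n\<close> after the head.\<close>
  define P where "P = (\<lambda>n (M, f, y). 0 \<le> M \<and> f \<in> Q \<and> y \<in> L \<and> (\<forall>x\<in>L. \<bar>f x\<bar> \<le> \<bar>f y\<bar>) \<and>
    \<bar>f y\<bar> > 4 ^ n * (3 / 2) * (M + real n))"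
  have "\<exists>s. \<forall>n. P n (s n) \<and> fst (s (Suc n)) = fst (s n) + B (snd (snd (s n))) / 4 ^ n"
  proof (rule dependent_nat_choice)
    show "\<exists>s. P 0 s"
      using peak[of 0] by (force simp: P_def)
  next
    fix s n assume "P n s"
    moreover obtain M f y where s: "s = (M, f, y)"
      by (cases s)
    ultimately have "0 \<le> M" "f \<in> Q" "y \<in> L"
      by (auto simp: P_def)
    moreover from this have "0 \<le> B y"
      using B by (meson abs_ge_zero order_trans)
    ultimately have M': "0 \<le> M + B y / 4 ^ n"
      by simp
    obtain g z where "g \<in> Q" "z \<in> L" "\<forall>x\<in>L. \<bar>g x\<bar> \<le> \<bar>g z\<bar>"
      "\<bar>g z\<bar> > 4 ^ Suc n * (3 / 2) * (M + B y / 4 ^ n + real (Suc n))"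
      using peak by metis
    with M' have "P (Suc n) (M + B y / 4 ^ n, g, z)"
      unfolding P_def by blast
    then show "\<exists>t. P (Suc n) t \<and> fst t = fst s + B (snd (snd s)) / 4 ^ n"
      using s by (intro exI[of _ "(M + B y / 4 ^ n, g, z)"]) simp
  qed
  then obtain s where s: "\<And>n. P n (s n)"
    and Ms: "\<And>n. fst (s (Suc n)) = fst (s n) + B (snd (snd (s n))) / 4 ^ n"
    by blast
  define M where "M = (\<lambda>n. fst (s n))"
  define f where "f = (\<lambda>n. fst (snd (s n)))"
  define y where "y = (\<lambda>n. snd (snd (s n)))"
  have M0: "0 \<le> M n" and fQ: "f n \<in> Q" and yL: "y n \<in> L"
    and fmax: "x \<in> L \<Longrightarrow> \<bar>f n x\<bar> \<le> \<bar>f n (y n)\<bar>"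
    and fbig: "\<bar>f n (y n)\<bar> > 4 ^ n * (3 / 2) * (M n + real n)" for n x
    using s[of n] by (auto simp: P_def M_def f_def y_def split: prod.splits)
  have Msum: "(\<Sum>j<n. \<bar>g (y j)\<bar> / 4 ^ j) \<le> M n" if "g \<in> Q" for g n
  proof (induction n)
    case 0
    then show ?case using M0 by simp
  next
    case (Suc n)
    have "\<bar>g (y n)\<bar> / 4 ^ n \<le> B (y n) / 4 ^ n"
      using B[OF yL that] by (simp add: divide_right_mono)
    then show ?case
      using Suc Ms[of n] by (simp add: M_def y_def)
  qed
  define \<phi> where "\<phi> = (\<lambda>g. \<Sum>n. g (y n) / (4::real) ^ n)"
  have "\<phi> \<in> cc_dual X"
    unfolding \<phi>_def by (rule weighted_evaluations_in_cc_dual[OF L yL])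
  then obtain b where b: "\<And>g. g \<in> Q \<Longrightarrow> \<bar>\<phi> g\<bar> \<le> b"
    using weakly_compact_imp_functional_bounded[OF Q] by blast
  have large: "\<bar>\<phi> (f n)\<bar> > real n" for n
  proof -
    define A where "A = \<bar>f n (y n)\<bar>"
    define a where "a = (\<lambda>j. f n (y j) / 4 ^ j)"
    have aA: "\<bar>a j\<bar> \<le> A * (1 / 4) ^ j" for j
      using fmax[OF yL, of n j] by (simp add: a_def A_def field_simps)
    have geo: "summable (\<lambda>j. A * (1 / 4 :: real) ^ j)"
      by (intro summable_mult summable_geometric) auto
    have sa: "summable a"
      using aA by (intro summable_comparison_test'[OF geo, of 0]) auto
    have "\<phi> (f n) = (\<Sum>j. a (j + Suc n)) + (\<Sum>j<Suc n. a j)"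
      unfolding \<phi>_def using suminf_split_initial_segment[OF sa, of "Suc n"] by (simp add: a_def)
    \<comment> \<open>The \<open>n\<close>-th term is set apart because it dominates tail and head
      together.\<close>
    then have split: "\<phi> (f n) = (\<Sum>j. a (j + Suc n)) + (\<Sum>j<n. a j) + a n"
      by simp
    have "(\<lambda>j. A * (1 / 4) ^ Suc n * (1 / 4) ^ j) sums (A * (1 / 4) ^ Suc n * (1 / (1 - 1 / 4)))"
      by (intro sums_mult geometric_sums) auto
    moreover have "A * (1 / 4) ^ Suc n * (1 / (1 - 1 / 4)) = A / 4 ^ n / 3"
      by (simp add: field_simps)
    ultimately have tail_sums: "(\<lambda>j. A * (1 / 4) ^ Suc n * (1 / 4) ^ j) sums (A / 4 ^ n / 3)"
      by simp
    have "norm (\<Sum>j. a (j + Suc n)) \<le> (\<Sum>j. A * (1 / 4) ^ Suc n * (1 / 4) ^ j)"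
    proof (rule norm_suminf_le)
      show "norm (a (j + Suc n)) \<le> A * (1 / 4) ^ Suc n * (1 / 4) ^ j" for j
        using aA[of "j + Suc n"] by (simp add: power_add mult_ac)
      show "summable (\<lambda>j. A * (1 / 4) ^ Suc n * (1 / 4) ^ j)"
        using tail_sums by (simp add: sums_iff)
    qed
    then have tail: "\<bar>\<Sum>j. a (j + Suc n)\<bar> \<le> A / 4 ^ n / 3"
      using tail_sums by (simp add: sums_iff)
    have "\<bar>\<Sum>j<n. a j\<bar> \<le> (\<Sum>j<n. \<bar>a j\<bar>)"
      by (rule sum_abs)
    also have "\<dots> \<le> M n"
      using Msum[OF fQ, of n n] by (simp add: a_def)
    finally have head: "\<bar>\<Sum>j<n. a j\<bar> \<le> M n" .
    have an: "\<bar>a n\<bar> = A / 4 ^ n"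
      by (simp add: a_def A_def)
    have "A / 4 ^ n > (3 / 2) * (M n + real n)"
      using fbig[of n] by (simp add: A_def field_simps)
    moreover have "\<bar>u + v + w\<bar> > k" if "(3 / 2) * (h + k) < t" "\<bar>u\<bar> \<le> t / 3" "\<bar>v\<bar> \<le> h" "\<bar>w\<bar> = t"
      for u v w h k t :: real
      using that by argo
    ultimately show ?thesis
      using split tail head an by metis
  qed
  obtain n where "b < real n"
    using reals_Archimedean2 by blast
  then show False
    using large[of n] b[OF fQ[of n]] by linarith
qed

section \<open>A countable k-network for the weak topology\<close>

text \<open>A finite cover of \<open>K\<close> already absorbs a tail of the sequence, so only
  finitely many further sets are needed.\<close>

lemma compact_Un_convergent_sequence:
  assumes K: "compactin X K" and y: "\<And>n::nat. y n \<in> topspace X"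
    and conv: "\<And>U. openin X U \<Longrightarrow> K \<subseteq> U \<Longrightarrow> \<exists>i. \<forall>n\<ge>i. y n \<in> U"
  shows "compactin X (K \<union> range y)"
  unfolding compactin_def
proof (intro conjI allI impI)
  show "K \<union> range y \<subseteq> topspace X"
    using y compactin_subset_topspace[OF K] by auto
next
  fix \<U> assume \<U>: "(\<forall>U\<in>\<U>. openin X U) \<and> K \<union> range y \<subseteq> \<Union>\<U>"
  then obtain \<F> where \<F>: "finite \<F>" "\<F> \<subseteq> \<U>" "K \<subseteq> \<Union>\<F>"
    using compactinD[OF K, of \<U>] by auto
  then obtain i where i: "\<And>n. n \<ge> i \<Longrightarrow> y n \<in> \<Union>\<F>"
    using conv[of "\<Union>\<F>"] \<U> by blast
  have "\<forall>n. \<exists>U\<in>\<U>. y n \<in> U"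
    using \<U> by blast
  then obtain V where V: "\<And>n. V n \<in> \<U>" "\<And>n. y n \<in> V n"
    by metis
  have "y n \<in> \<Union>(\<F> \<union> V ` {..<i})" for n
    using i[of n] V(2)[of n] by (cases "n < i") auto
  then have "K \<union> range y \<subseteq> \<Union>(\<F> \<union> V ` {..<i})"
    using \<F>(3) by blast
  moreover have "finite (\<F> \<union> V ` {..<i})" "\<F> \<union> V ` {..<i} \<subseteq> \<U>"
    using \<F> V(1) by auto
  ultimately show "\<exists>\<F>. finite \<F> \<and> \<F> \<subseteq> \<U> \<and> K \<union> range y \<subseteq> \<Union>\<F>"
    by blast
qed

text \<open>The intersections make it possible to meet the first \<open>n\<close> network covers of
  a compact set at once while the family remains countable.\<close>

definition finite_lattice_closure :: "'a set set \<Rightarrow> 'a set set" where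
  "finite_lattice_closure \<N> = (\<lambda>\<G>. \<Inter>(Union ` \<G>)) ` {\<G>. finite \<G> \<and> \<G> \<subseteq> {\<F>. finite \<F> \<and> \<F> \<subseteq> \<N>}}"

lemma countable_finite_lattice_closure:
  "countable \<N> \<Longrightarrow> countable (finite_lattice_closure \<N>)"
  unfolding finite_lattice_closure_def
  by (intro countable_image countable_Collect_finite_subset)

text \<open>The compact sets of \<open>X\<close> may be uncountably many, so bounds on them cannot
  index a countable network; replacing \<open>K\<close> by a set from a countable lattice removes
  this obstacle.\<close>

lemma weakly_compact_imp_bounded_on_network_set:
  assumes \<N>: "countable \<N>" "k_network X \<N>"
    and Q: "compactin (cc_weak X) Q" and K: "compactin X K"
  shows "\<exists>N\<in>finite_lattice_closure \<N>. \<exists>m::nat. K \<subseteq> N \<and> (\<forall>f\<in>Q. \<forall>x\<in>N. \<bar>f x\<bar> \<le> real m)"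
proof (rule ccontr)
  assume "\<not> ?thesis"
  then have unbdd: "\<exists>f\<in>Q. \<exists>x\<in>N. \<bar>f x\<bar> > real m"
    if "N \<in> finite_lattice_closure \<N>" "K \<subseteq> N" for N m
    using that by (meson not_le)
  have QX: "Q \<subseteq> cfun X"
    using compactin_subset_topspace[OF Q] by (simp add: topspace_cc_weak)
  define \<M> where "\<M> = {\<F>. (finite \<F> \<and> \<F> \<subseteq> \<N>) \<and> K \<subseteq> \<Union>\<F>}"
  have "countable {\<F>. finite \<F> \<and> \<F> \<subseteq> \<N>}"
    by (rule countable_Collect_finite_subset[OF \<N>(1)])
  then have "countable \<M>"
    by (rule countable_subset[rotated]) (auto simp: \<M>_def)
  have network: "\<exists>\<F>\<in>\<M>. \<Union>\<F> \<subseteq> U" if "openin X U" "K \<subseteq> U" for U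
  proof -
    obtain \<F> where "finite \<F>" "\<F> \<subseteq> \<N>" "K \<subseteq> \<Union>\<F>" "\<Union>\<F> \<subseteq> U"
      using \<N>(2) K \<open>openin X U\<close> \<open>K \<subseteq> U\<close> unfolding k_network_def by meson
    then show ?thesis
      by (auto simp: \<M>_def)
  qed
  have "\<M> \<noteq> {}"
    using network[OF openin_topspace] compactin_subset_topspace[OF K] by blast
  define M where "M = from_nat_into \<M>"
  have M: "range M = \<M>"
    unfolding M_def using \<open>\<M> \<noteq> {}\<close> \<open>countable \<M>\<close> by (rule range_from_nat_into)
  \<comment> \<open>These sets decrease, and since the \<open>M i\<close> exhaust the finite network
    covers of \<open>K\<close>, any choice of \<open>x n\<close> in \<open>N n\<close> eventually
    stays in each open set containing \<open>K\<close>.\<close>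
  define N where "N n = \<Inter>(Union ` (M ` {..n}))" for n
  have M_props: "finite (M i)" "M i \<subseteq> \<N>" "K \<subseteq> \<Union>(M i)" for i
    using M by (auto simp: \<M>_def)
  have "N n \<in> finite_lattice_closure \<N>" for n
    unfolding finite_lattice_closure_def N_def using M_props by (intro imageI) auto
  moreover have "K \<subseteq> N n" for n
    using M_props(3) unfolding N_def by blast
  ultimately have "\<forall>n. \<exists>f x. f \<in> Q \<and> x \<in> N n \<and> \<bar>f x\<bar> > real n"
    using unbdd by blast
  then obtain f x where f: "\<And>n. f n \<in> Q" and x: "\<And>n. x n \<in> N n"
    and big: "\<And>n. \<bar>f n (x n)\<bar> > real n"
    by metis
  \<comment> \<open>Network sets may leave the space, but functions in \<open>cfun X\<close> vanish
    there, contrary to \<open>big\<close>.\<close>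
  have xX: "x n \<in> topspace X" for n
  proof (rule ccontr)
    assume "x n \<notin> topspace X"
    moreover have "f n \<in> cfun X"
      using f QX by blast
    ultimately show False
      using big[of n] by (simp add: cfun_def)
  qed
  have "compactin X (K \<union> range x)"
  proof (rule compact_Un_convergent_sequence[OF K xX])
    fix U assume "openin X U" "K \<subseteq> U"
    then obtain i where "\<Union>(M i) \<subseteq> U"
      using network M by (metis rangeE)
    then have "\<forall>n\<ge>i. x n \<in> U"
      using x by (fastforce simp: N_def)
    then show "\<exists>i. \<forall>n\<ge>i. x n \<in> U"
      by blast
  qed
  then obtain b where b: "\<And>g z. g \<in> Q \<Longrightarrow> z \<in> K \<union> range x \<Longrightarrow> \<bar>g z\<bar> \<le> b"
    using weakly_compact_imp_bounded_on_compact[OF Q] by blast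
  obtain n where "b < real n"
    using reals_Archimedean2 by blast
  then show False
    using big[of n] b[OF f[of n], of "x n"] by auto
qed

section \<open>Rational boxes of pointwise convergence\<close>

text \<open>Encoding by lists makes the boxes with rational centres and radii a countable family,
  and concatenation of lists intersects boxes.\<close>

definition pointwise_box :: "'a topology \<Rightarrow> ('a \<times> real \<times> real) list \<Rightarrow> ('a \<Rightarrow> real) set" where
  "pointwise_box X l = {g \<in> cfun X. \<forall>(x, q, r) \<in> set l. \<bar>g x - q\<bar> < r}"

lemma openin_pointwise_box:
  assumes "fst ` set l \<subseteq> topspace X"
  shows "openin (cc_weak X) (pointwise_box X l)"
  using assms
proof (induction l)
  case Nil
  then show ?case
    using openin_topspace[of "cc_weak X"] by (simp add: pointwise_box_def topspace_cc_weak)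
next
  case (Cons t l)
  obtain x q r where t: "t = (x, q, r)"
    by (cases t)
  have "openin (cc_weak X) {g \<in> cfun X. g x \<in> ball q r}"
    using Cons t by (intro openin_cc_weak_preimage evaluation_in_cc_dual) auto
  moreover have "openin (cc_weak X) (pointwise_box X l)"
    using Cons by auto
  ultimately have "openin (cc_weak X) ({g \<in> cfun X. g x \<in> ball q r} \<inter> pointwise_box X l)"
    by blast
  moreover have "{g \<in> cfun X. g x \<in> ball q r} \<inter> pointwise_box X l = pointwise_box X (t # l)"
    by (auto simp: pointwise_box_def t dist_real_def)
  ultimately show ?case by simp
qed

lemma pointwise_box_neighbourhood:
  assumes "finite F" "F \<subseteq> topspace X" "d > 0" "f \<in> cfun X"
  shows "\<exists>l\<in>lists (topspace X \<times> \<rat> \<times> \<rat>). f \<in> pointwise_box X l \<and>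
    (\<forall>g\<in>pointwise_box X l. \<forall>x\<in>F. \<bar>g x - f x\<bar> \<le> d)"
proof -
  \<comment> \<open>Both \<open>f x\<close> and \<open>g x\<close> will lie within \<open>r\<close>
    of a rational centre, so \<open>r < d / 2\<close> keeps them within \<open>d\<close> of each
    other.\<close>
  obtain r where r: "r \<in> \<rat>" "0 < r" "r < d / 2"
    using Rats_dense_in_real[of 0 "d/2"] assms(3) by auto
  have "\<exists>q\<in>\<rat>. \<bar>f x - q\<bar> < r" for x
    using Rats_dense_in_real[of "f x" "f x + r"] r by force
  then obtain q where q: "\<And>x. q x \<in> \<rat>" "\<And>x. \<bar>f x - q x\<bar> < r"
    by metis
  obtain xs where xs: "set xs = F"
    using assms(1) finite_list by blast
  define l where "l = map (\<lambda>x. (x, q x, r)) xs"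
  have "l \<in> lists (topspace X \<times> \<rat> \<times> \<rat>)"
    using xs assms(2) q r by (auto simp: l_def)
  moreover have "f \<in> pointwise_box X l"
    using assms q by (auto simp: pointwise_box_def l_def)
  moreover have "\<bar>g x - f x\<bar> \<le> d" if "g \<in> pointwise_box X l" "x \<in> F" for g x
  proof -
    have "\<bar>g x - q x\<bar> < r"
      using that xs by (auto simp: pointwise_box_def l_def)
    then show ?thesis
      using q(2)[of x] r by linarith
  qed
  ultimately show ?thesis by blast
qed

text \<open>\<open>K\<close> depends on \<open>W\<close> and \<open>f\<close> but not on
  \<open>m\<close>, so the bound can be chosen afterwards, from the weakly compact set at hand.
  Subbasic sets are handled by \<open>pointwise_continuous_on_bounded\<close>.\<close>

lemma weak_neighbourhood_contains_bounded_box: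
  assumes dim: "X dim_le 0" and count: "countable (topspace X)"
    and "openin (cc_weak X) W" "f \<in> W"
  shows "\<exists>K. compactin X K \<and> (\<forall>m>0. (\<forall>x\<in>K. \<bar>f x\<bar> \<le> m) \<longrightarrow>
    (\<exists>l\<in>lists (topspace X \<times> \<rat> \<times> \<rat>). f \<in> pointwise_box X l \<and>
      {g \<in> pointwise_box X l. \<forall>x\<in>K. \<bar>g x\<bar> \<le> m} \<subseteq> W))"
proof -
  have "generate_topology_on {{f \<in> cfun X. \<phi> f \<in> U} | \<phi> U. \<phi> \<in> cc_dual X \<and> open U} W"
    using assms(3) by (simp add: cc_weak_def openin_topology_generated_by_iff)
  then show ?thesis
    using assms(4)
  proof induction
    case Empty
    then show ?case by simp
  next
    case (Int a b)
    obtain K where K: "compactin X K" "\<And>m. m > 0 \<Longrightarrow> (\<forall>x\<in>K. \<bar>f x\<bar> \<le> m) \<Longrightarrow>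
      \<exists>l\<in>lists (topspace X \<times> \<rat> \<times> \<rat>). f \<in> pointwise_box X l \<and>
        {g \<in> pointwise_box X l. \<forall>x\<in>K. \<bar>g x\<bar> \<le> m} \<subseteq> a"
      using Int.IH(1) Int.prems by auto
    obtain L where L: "compactin X L" "\<And>m. m > 0 \<Longrightarrow> (\<forall>x\<in>L. \<bar>f x\<bar> \<le> m) \<Longrightarrow>
      \<exists>l\<in>lists (topspace X \<times> \<rat> \<times> \<rat>). f \<in> pointwise_box X l \<and>
        {g \<in> pointwise_box X l. \<forall>x\<in>L. \<bar>g x\<bar> \<le> m} \<subseteq> b"
      using Int.IH(2) Int.prems by auto
    have "\<exists>l\<in>lists (topspace X \<times> \<rat> \<times> \<rat>). f \<in> pointwise_box X l \<and>
        {g \<in> pointwise_box X l. \<forall>x\<in>K \<union> L. \<bar>g x\<bar> \<le> m} \<subseteq> a \<inter> b"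
      if m: "m > 0" "\<forall>x\<in>K \<union> L. \<bar>f x\<bar> \<le> m" for m
    proof -
      obtain k where k: "k \<in> lists (topspace X \<times> \<rat> \<times> \<rat>)" "f \<in> pointwise_box X k"
        "{g \<in> pointwise_box X k. \<forall>x\<in>K. \<bar>g x\<bar> \<le> m} \<subseteq> a"
        using K(2)[of m] m by auto
      obtain l where l: "l \<in> lists (topspace X \<times> \<rat> \<times> \<rat>)" "f \<in> pointwise_box X l"
        "{g \<in> pointwise_box X l. \<forall>x\<in>L. \<bar>g x\<bar> \<le> m} \<subseteq> b"
        using L(2)[of m] m by auto
      have "pointwise_box X (k @ l) = pointwise_box X k \<inter> pointwise_box X l"
        unfolding pointwise_box_def set_append ball_Un by blast
      then show ?thesis
        using k l by (intro bexI[of _ "k @ l"]) auto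
    qed
    then show ?case
      using compactin_Un[OF K(1) L(1)] by blast
  next
    case (UN \<K>)
    then obtain k where k: "k \<in> \<K>" "f \<in> k"
      by blast
    show ?case
      using UN.IH[OF k] k(1) by (meson Union_upper order_trans)
  next
    case (Basis s)
    then obtain \<phi> U where s: "s = {f \<in> cfun X. \<phi> f \<in> U}" "\<phi> \<in> cc_dual X" "open U"
      by auto
    then obtain e where e: "e > 0" "ball (\<phi> f) e \<subseteq> U"
      using Basis open_contains_ball by blast
    obtain K C where "compactly_bounded_functional X K C \<phi>"
      using s cc_dual_iff by blast
    then interpret compactly_bounded_functional X K C \<phi> .
    have f: "f \<in> cfun X"
      using Basis s by auto
    have "\<exists>l\<in>lists (topspace X \<times> \<rat> \<times> \<rat>). f \<in> pointwise_box X l \<and>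
        {g \<in> pointwise_box X l. \<forall>x\<in>K. \<bar>g x\<bar> \<le> m} \<subseteq> s"
      if m: "m > 0" "\<forall>x\<in>K. \<bar>f x\<bar> \<le> m" for m
    proof -
      obtain F d where F: "finite F" "F \<subseteq> K" "d > 0"
        "\<And>g. g \<in> cfun X \<Longrightarrow> (\<forall>x\<in>K. \<bar>g x\<bar> \<le> m) \<Longrightarrow> (\<forall>x\<in>F. \<bar>g x - f x\<bar> \<le> d) \<Longrightarrow> \<bar>\<phi> g - \<phi> f\<bar> < e"
        using pointwise_continuous_on_bounded[OF dim count e(1) m(1) f] m(2) by metis
      have "F \<subseteq> topspace X"
        using F(2) compactin_subset_topspace[OF compact] by blast
      then obtain l where l: "l \<in> lists (topspace X \<times> \<rat> \<times> \<rat>)" "f \<in> pointwise_box X l"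
        "\<forall>g\<in>pointwise_box X l. \<forall>x\<in>F. \<bar>g x - f x\<bar> \<le> d"
        using pointwise_box_neighbourhood[OF F(1) _ F(3) f] by blast
      have "g \<in> s" if g: "g \<in> pointwise_box X l" "\<forall>x\<in>K. \<bar>g x\<bar> \<le> m" for g
      proof -
        have gX: "g \<in> cfun X"
          using g by (simp add: pointwise_box_def)
        then have "\<phi> g \<in> ball (\<phi> f) e"
          using F(4)[OF gX g(2)] l(3) g(1) by (auto simp: dist_real_def)
        then show ?thesis
          using s e gX by auto
      qed
      then show ?thesis
        using l by blast
    qed
    then show ?case
      using compact by blast
  qed
qed

theorem theorem7p2:
  fixes X :: "'a topology"
  assumes "countable (topspace X)"
    and "aleph0_space X"
  shows "aleph0_space (cc_weak X)"
proof -
  obtain \<N> where \<N>: "countable \<N>" "k_network X \<N>" and "regular_space X"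
    using assms(2) by (auto simp: aleph0_space_def)
  have dim: "X dim_le 0"
    by (rule countable_regular_imp_dim_le_0) fact+
  define D where "D = lists (topspace X \<times> (\<rat> :: real set) \<times> (\<rat> :: real set))"
  \<comment> \<open>The bound is imposed on a lattice set \<open>N\<close>, not on a compact set, so
    all three parameters range over countable sets.\<close>
  define E where "E = (\<lambda>(l, N, m). {g \<in> pointwise_box X l. \<forall>x\<in>N. \<bar>g x\<bar> \<le> real m})"
  define \<E> where "\<E> = E ` (D \<times> finite_lattice_closure \<N> \<times> UNIV)"
  have "countable \<E>"
    unfolding \<E>_def D_def using assms(1) countable_finite_lattice_closure[OF \<N>(1)]
    by (intro countable_image countable_SIGMA countable_lists) (auto intro: countable_rat)
  moreover have "k_network (cc_weak X) \<E>"
    unfolding k_network_def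
  proof (intro allI impI)
    fix Q W assume "compactin (cc_weak X) Q \<and> openin (cc_weak X) W \<and> Q \<subseteq> W"
    then have Q: "compactin (cc_weak X) Q" and W: "openin (cc_weak X) W" "Q \<subseteq> W"
      by auto
    have "\<forall>f\<in>Q. \<exists>l N m. l \<in> D \<and> N \<in> finite_lattice_closure \<N> \<and> f \<in> pointwise_box X l \<and>
        (\<forall>g\<in>Q. \<forall>x\<in>N. \<bar>g x\<bar> \<le> real m) \<and> E (l, N, m) \<subseteq> W"
    proof
      fix f assume f: "f \<in> Q"
      obtain K where K: "compactin X K" "\<And>m. m > 0 \<Longrightarrow> (\<forall>x\<in>K. \<bar>f x\<bar> \<le> m) \<Longrightarrow>
        \<exists>l\<in>D. f \<in> pointwise_box X l \<and> {g \<in> pointwise_box X l. \<forall>x\<in>K. \<bar>g x\<bar> \<le> m} \<subseteq> W"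
        using weak_neighbourhood_contains_bounded_box[OF dim assms(1) W(1), of f] W(2) f
        unfolding D_def by blast
      obtain N m where N: "N \<in> finite_lattice_closure \<N>" "K \<subseteq> N"
        "\<forall>g\<in>Q. \<forall>x\<in>N. \<bar>g x\<bar> \<le> real m"
        using weakly_compact_imp_bounded_on_network_set[OF \<N> Q K(1)] by blast
      \<comment> \<open>The choice of a box asks for a positive bound, while \<open>m\<close> may be
        0.\<close>
      have NS: "\<forall>g\<in>Q. \<forall>x\<in>N. \<bar>g x\<bar> \<le> real (Suc m)"
        using N(3) by force
      then obtain l where l: "l \<in> D" "f \<in> pointwise_box X l"
        "{g \<in> pointwise_box X l. \<forall>x\<in>K. \<bar>g x\<bar> \<le> real (Suc m)} \<subseteq> W"
        using K(2)[of "real (Suc m)"] f N(2) by fastforce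
      then have "E (l, N, Suc m) \<subseteq> W"
        using N(2) by (auto simp: E_def)
      then show "\<exists>l N m. l \<in> D \<and> N \<in> finite_lattice_closure \<N> \<and> f \<in> pointwise_box X l \<and>
        (\<forall>g\<in>Q. \<forall>x\<in>N. \<bar>g x\<bar> \<le> real m) \<and> E (l, N, m) \<subseteq> W"
        using l N(1) NS by blast
    qed
    then obtain l N m where lNm: "\<And>f. f \<in> Q \<Longrightarrow> l f \<in> D \<and> N f \<in> finite_lattice_closure \<N> \<and>
        f \<in> pointwise_box X (l f) \<and> (\<forall>g\<in>Q. \<forall>x\<in>N f. \<bar>g x\<bar> \<le> real (m f)) \<and> E (l f, N f, m f) \<subseteq> W"
      by metis
    \<comment> \<open>Compactness is applied to the open boxes. Every element of \<open>Q\<close>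
      obeys the bounds on each \<open>N f\<close>, so shrinking a box to the set given by
      \<open>E\<close> loses no point of \<open>Q\<close>.\<close>
    have "openin (cc_weak X) (pointwise_box X (l f))" if "f \<in> Q" for f
      using lNm[OF that] by (intro openin_pointwise_box) (auto simp: D_def)
    then have "\<exists>\<F>. finite \<F> \<and> \<F> \<subseteq> (\<lambda>f. pointwise_box X (l f)) ` Q \<and> Q \<subseteq> \<Union>\<F>"
      using lNm by (intro compactinD[OF Q]) auto
    then obtain F where F: "finite F" "F \<subseteq> Q" "Q \<subseteq> (\<Union>f\<in>F. pointwise_box X (l f))"
      by (metis finite_subset_image)
    define \<F> where "\<F> = (\<lambda>f. E (l f, N f, m f)) ` F"
    have "finite \<F>"
      using F by (simp add: \<F>_def)
    moreover have "\<F> \<subseteq> \<E>"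
      unfolding \<F>_def \<E>_def using F(2) lNm by (intro image_subsetI imageI) blast
    moreover have "\<Union>\<F> \<subseteq> W"
      unfolding \<F>_def using F(2) lNm by blast
    moreover have "Q \<subseteq> \<Union>\<F>"
    proof
      fix g assume "g \<in> Q"
      then obtain f where "f \<in> F" "g \<in> pointwise_box X (l f)"
        using F(3) by blast
      then show "g \<in> \<Union>\<F>"
        using lNm[of f] F(2) \<open>g \<in> Q\<close> unfolding \<F>_def E_def by blast
    qed
    ultimately show "\<exists>\<F>. finite \<F> \<and> \<F> \<subseteq> \<E> \<and> Q \<subseteq> \<Union>\<F> \<and> \<Union>\<F> \<subseteq> W"
      by blast
  qed
  ultimately show ?thesis
    using regular_space_cc_weak by (auto simp: aleph0_space_def)
qed

end
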